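(* Let $\mathfrak{S}$ be a faithful cartesian club, $\mathcal{M}$ an $\mathfrak{S}$-multicategory, and $(A,\bullet)$ a weakly $\mathfrak{S}$-combinatory complete applicative system in $\mathcal{M}$. Then $(A,\bullet)$ is flipped if and only if it is $\mathfrak{S}$-combinatory complete.
   Context: Clubs. $\mathbf{Fun}$ is the category with objects the natural numbers and morphisms $n\to m$ the functions $\underline{n}\to\underline{m}$, where $\underline{n}=\{1,\ldots,n\}$. For $\mathbf{a}:n\to m$, $\mathbf{b}:h\to k$, $\mathbf{a}+\mathbf{b}:n+h\to m+k$ is $x\mapsto\mathbf{a}(x)$ for $x\le n$ and $x\mapsto\mathbf{b}(x-n)+m$ for $x>n$. For $\mathbf{a}:m\to n$ and $k_1,\ldots,k_n\in\mathbb{N}$, the wreath product $\mathbf{a}\wr(k_1,\ldots,k_n):\sum_{j=1}^m k_{\mathbf{a}(j)}\to\sum_{i=1}^n k_i$ sends the $p$-th element of the $j$-th block (of size $k_{\mathbf{a}(j)}$) to the $p$-th element of the $\mathbf{a}(j)$-th block. A faithful cartesian club is a subcategory $\mathfrak{S}$ of $\mathbf{Fun}$ containing all objects and closed under $+$ and under $\mathbf{a}\mapsto\mathbf{a}\wr(k_1,\ldots,k_n)$ for all $k_i$. Multicategories. A multicategory $\mathcal{M}$ has objects $\mathcal{M}_0$, morphism sets $\mathcal{M}(A_1,\ldots,A_n;B)$ ($n\ge 0$), identities $1_A\in\mathcal{M}(A;A)$, and associative unital composition sending $f\in\mathcal{M}(A_1,\ldots,A_n;B)$, $g_i\in\mathcal{M}(\Gamma_i;A_i)$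 to $f\circ(g_1,\ldots,g_n)\in\mathcal{M}(\Gamma_1,\ldots,\Gamma_n;B)$. $A^n$ (resp. $f^n$) means $n$ copies of $A$ (resp. $f$). An $\mathfrak{S}$-multicategory is a multicategory with operations $[-]\mathbf{a}:\mathcal{M}(A_{\mathbf{a}(1)},\ldots,A_{\mathbf{a}(m)};B)\to\mathcal{M}(A_1,\ldots,A_n;B)$ for each $\mathbf{a}:m\to n$ in $\mathfrak{S}$, such that $[[f]\mathbf{a}]\mathbf{b}=[f](\mathbf{b}\circ\mathbf{a})$; $[f]1=f$; $g\circ([f_1]\mathbf{a}_1,\ldots,[f_n]\mathbf{a}_n)=[g\circ(f_1,\ldots,f_n)](\mathbf{a}_1+\cdots+\mathbf{a}_n)$; and $[g]\mathbf{a}\circ(f_1,\ldots,f_n)=[g\circ(f_{\mathbf{a}(1)},\ldots,f_{\mathbf{a}(m)})](\mathbf{a}\wr(k_1,\ldots,k_n))$ where $k_i$ is the arity of $f_i$. A sub-$\mathfrak{S}$-multicategory is given by subcollections of objects and of morphisms containing identities and closed under composition and under the action of $\mathfrak{S}$. Applicative systems. An applicative system $(A,\bullet)$ in $\mathcal{M}$ is an object $A$ with $\bullet\in\mathcal{M}(A,A;A)$. Put $\bullet^0=1_A$, $\bullet^{n+1}=\bullet\circ(\bullet^n,1_A)\in\mathcal{M}(A,A^{n+1};A)$. $f\in\mathcal{M}(A^n;A)$ is $(A,\bullet)$-computable if $f=\bullet^n\circ(a,1_A^n)$ for some $a\in\mathcal{M}(;A)$. $(A,\bullet)$ is weakly $\mathfrak{S}$-combinatory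 complete if every morphism of the smallest sub-$\mathfrak{S}$-multicategory of $\mathcal{M}$ containing $\bullet$ is $(A,\bullet)$-computable. $(A,\bullet)$ is $\mathfrak{S}$-combinatory complete if every morphism of the smallest sub-$\mathfrak{S}$-multicategory of $\mathcal{M}$ containing $\bullet$ and all $a\in\mathcal{M}(;A)$ is $(A,\bullet)$-computable. $(A,\bullet)$ is flipped if for every $a\in\mathcal{M}(;A)$ there exists $h\in\mathcal{M}(;A)$ with $\bullet\circ(h,1_A)=\bullet\circ(1_A,a)$. *)

theory Defs
  imports Main "HOL-Library.FuncSet"
begin

section \<open>The category Fun and faithful cartesian clubs\<close>

text \<open>A morphism of Fun carries its source and target. The object \<open>n\<close> stands
  for \<open>{1..n}\<close>; underlying functions are extensional, so that equality of morphisms is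
  equality of the triples.\<close>

datatype farr = Farr (fdom: nat) (fcod: nat) (fapp: "nat \<Rightarrow> nat")

definition is_farr :: "farr \<Rightarrow> bool" where
  "is_farr a \<longleftrightarrow> fapp a \<in> {1..fdom a} \<rightarrow>\<^sub>E {1..fcod a}"

definition fid :: "nat \<Rightarrow> farr" where
  "fid n = Farr n n (\<lambda>x\<in>{1..n}. x)"

definition fcomp :: "farr \<Rightarrow> farr \<Rightarrow> farr" where
  "fcomp b a = Farr (fdom a) (fcod b) (compose {1..fdom a} (fapp b) (fapp a))"

definition fplus :: "farr \<Rightarrow> farr \<Rightarrow> farr" where
  "fplus a b = Farr (fdom a + fdom b) (fcod a + fcod b)
     (\<lambda>x\<in>{1..fdom a + fdom b}.
        if x \<le> fdom a then fapp a x else fapp b (x - fdom a) + fcod a)"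

definition fsum :: "farr list \<Rightarrow> farr" where
  "fsum as = foldr fplus as (fid 0)"

text \<open>For \<open>a : m \<rightarrow> n\<close> and \<open>xs = [x\<^sub>1, \<dots>, x\<^sub>n]\<close>, the list
  \<open>[x\<^bsub>a(1)\<^esub>, \<dots>, x\<^bsub>a(m)\<^esub>]\<close>; the shift by one is due to lists being indexed from 0.\<close>

definition reindex :: "farr \<Rightarrow> 'b list \<Rightarrow> 'b list" where
  "reindex a xs = map (\<lambda>j. xs ! (fapp a j - 1)) [1..<Suc (fdom a)]"

text \<open>The position \<open>x\<close> lies in the \<open>j\<close>-th block of the source for the least \<open>j\<close> such that the
  first \<open>j\<close> blocks have at least \<open>x\<close> elements; it is the \<open>p\<close>-th element of that block, where
  \<open>p\<close> is \<open>x\<close> minus the total size of the preceding blocks. See \<open>fapp_wreath\<close> below.\<close>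

definition wreath :: "farr \<Rightarrow> nat list \<Rightarrow> farr" where
  "wreath a ks =
     (let N = sum_list (reindex a ks) in
      Farr N (sum_list ks)
        (\<lambda>x\<in>{1..N}.
           let j = (LEAST j. x \<le> sum_list (take j (reindex a ks)));
               p = x - sum_list (take (j - 1) (reindex a ks))
           in sum_list (take (fapp a j - 1) ks) + p))"

lemma length_reindex [simp]: "length (reindex a xs) = fdom a"
  by (simp add: reindex_def)

lemma nth_reindex:
  "j \<in> {1..fdom a} \<Longrightarrow> reindex a xs ! (j - 1) = xs ! (fapp a j - 1)"
  by (auto simp: reindex_def nth_append simp del: upt_Suc)

lemma sum_list_take_mono:
  fixes xs :: "nat list"
  assumes "i \<le> j"
  shows "sum_list (take i xs) \<le> sum_list (take j xs)"
proof -
  have "take j xs = take i xs @ take (j - i) (drop i xs)"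
    using assms by (metis le_add_diff_inverse take_add)
  then show ?thesis by simp
qed

lemma sum_list_take_step:
  fixes xs :: "nat list"
  assumes "j \<in> {1..length xs}"
  shows "sum_list (take j xs) = sum_list (take (j - 1) xs) + xs ! (j - 1)"
  using assms take_Suc_conv_app_nth[of "j - 1" xs] by auto

lemma fapp_wreath:
  assumes j: "j \<in> {1..fdom a}" and p: "p \<in> {1..ks ! (fapp a j - 1)}"
  shows "fapp (wreath a ks) (sum_list (take (j - 1) (reindex a ks)) + p) =
         sum_list (take (fapp a j - 1) ks) + p"
proof -
  let ?S = "\<lambda>i. sum_list (take i (reindex a ks))"
  let ?x = "?S (j - 1) + p"
  have step: "?S j = ?S (j - 1) + ks ! (fapp a j - 1)"
    using j sum_list_take_step[of j "reindex a ks"] nth_reindex[of j a ks] by simp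
  have "?x \<le> ?S j" using p step by simp
  also have "?S j \<le> ?S (fdom a)"
    using j by (intro sum_list_take_mono) simp
  finally have "?x \<le> sum_list (reindex a ks)" by simp
  moreover have "(LEAST i. ?x \<le> ?S i) = j"
  proof (rule Least_equality)
    show "?x \<le> ?S j" using p step by simp
  next
    fix i assume i: "?x \<le> ?S i"
    show "j \<le> i"
    proof (rule ccontr)
      assume "\<not> j \<le> i"
      then have "?S i \<le> ?S (j - 1)" by (intro sum_list_take_mono) simp
      then show False using i p by simp
    qed
  qed
  ultimately show ?thesis
    using p by (simp add: wreath_def Let_def)
qed

lemma is_farr_fid: "is_farr (fid n)"
  by (auto simp: is_farr_def fid_def)

lemma is_farr_fcomp:
  "\<lbrakk>is_farr a; is_farr b; fcod a = fdom b\<rbrakk> \<Longrightarrow> is_farr (fcomp b a)"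
  by (auto simp: is_farr_def fcomp_def compose_def PiE_iff)

lemma is_farr_fplus:
  assumes a: "is_farr a" and b: "is_farr b"
  shows "is_farr (fplus a b)"
proof -
  have A: "1 \<le> fapp a x \<and> fapp a x \<le> fcod a" if "1 \<le> x" "x \<le> fdom a" for x
    using a that by (auto simp: is_farr_def PiE_iff)
  have B: "1 \<le> fapp b x \<and> fapp b x \<le> fcod b" if "1 \<le> x" "x \<le> fdom b" for x
    using b that by (auto simp: is_farr_def PiE_iff)
  have "(if x \<le> fdom a then fapp a x else fapp b (x - fdom a) + fcod a) \<in> {1..fcod a + fcod b}"
    if "1 \<le> x" "x \<le> fdom a + fdom b" for x
  proof (cases "x \<le> fdom a")
    case True
    then show ?thesis using that A[of x] by auto
  next
    case False
    then have "1 \<le> x - fdom a" "x - fdom a \<le> fdom b" using that by auto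
    then show ?thesis using B[of "x - fdom a"] False by auto
  qed
  then show ?thesis
    unfolding is_farr_def fplus_def farr.sel
    by (intro restrict_PiE_iff[THEN iffD2] ballI) simp
qed

lemma is_farr_wreath:
  assumes a: "is_farr a" and ks: "length ks = fcod a"
  shows "is_farr (wreath a ks)"
proof -
  let ?S = "\<lambda>i. sum_list (take i (reindex a ks))"
  have "fapp (wreath a ks) x \<in> {1..sum_list ks}" if x: "1 \<le> x" "x \<le> sum_list (reindex a ks)" for x
  proof -
    define j where "j = (LEAST j. x \<le> ?S j)"
    have ex: "x \<le> ?S (fdom a)" using x by simp
    have le: "x \<le> ?S j" unfolding j_def by (rule LeastI[of "\<lambda>j. x \<le> ?S j", OF ex])
    have jm: "j \<le> fdom a" unfolding j_def by (rule Least_le[of "\<lambda>j. x \<le> ?S j", OF ex])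
    have j0: "j \<noteq> 0" using le x by (cases j) auto
    have lt: "?S (j - 1) < x"
      using not_less_Least[of "j - 1" "\<lambda>j. x \<le> ?S j"] j0 by (simp add: j_def)
    have jin: "j \<in> {1..fdom a}" using jm j0 by simp
    have step: "?S j = ?S (j - 1) + ks ! (fapp a j - 1)"
      using jin sum_list_take_step[of j "reindex a ks"] nth_reindex[of j a ks] by simp
    have aj: "fapp a j \<in> {1..length ks}" using a jin ks by (auto simp: is_farr_def PiE_iff)
    define p where "p = x - ?S (j - 1)"
    have p: "p \<in> {1..ks ! (fapp a j - 1)}" using lt le step by (auto simp: p_def)
    have "fapp (wreath a ks) x = sum_list (take (fapp a j - 1) ks) + p"
      using fapp_wreath[OF jin p] lt by (simp add: p_def)
    moreover have "sum_list (take (fapp a j) ks) \<le> sum_list ks"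
      using sum_list_take_mono[of "fapp a j" "length ks" ks] aj by simp
    ultimately show ?thesis using p sum_list_take_step[OF aj] by auto
  qed
  moreover have "fapp (wreath a ks) \<in> extensional {1..sum_list (reindex a ks)}"
    by (simp add: wreath_def Let_def)
  ultimately show ?thesis
    by (simp add: is_farr_def PiE_iff wreath_def Let_def)
qed

locale faithful_cartesian_club =
  fixes S :: "farr set"
  assumes farr: "a \<in> S \<Longrightarrow> is_farr a"
    and fid_closed: "fid n \<in> S"
    and fcomp_closed: "\<lbrakk>a \<in> S; b \<in> S; fcod a = fdom b\<rbrakk> \<Longrightarrow> fcomp b a \<in> S"
    and fplus_closed: "\<lbrakk>a \<in> S; b \<in> S\<rbrakk> \<Longrightarrow> fplus a b \<in> S"
    and wreath_closed: "\<lbrakk>a \<in> S; length ks = fcod a\<rbrakk> \<Longrightarrow> wreath a ks \<in> S"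


section \<open>Multicategories\<close>

text \<open>A morphism determines its source list and its target; \<open>Hom M As B\<close> is the paper's
  \<open>M(A\<^sub>1, \<dots>, A\<^sub>n; B)\<close>.\<close>

record ('o, 'm) multicategory =
  Obj :: "'o set"
  Mor :: "'m set"
  src :: "'m \<Rightarrow> 'o list"
  tgt :: "'m \<Rightarrow> 'o"
  ident :: "'o \<Rightarrow> 'm"
  mcomp :: "'m \<Rightarrow> 'm list \<Rightarrow> 'm"

definition Hom :: "('o, 'm, 'x) multicategory_scheme \<Rightarrow> 'o list \<Rightarrow> 'o \<Rightarrow> 'm set" where
  "Hom M As B = {f \<in> Mor M. src M f = As \<and> tgt M f = B}"

definition composable :: "('o, 'm, 'x) multicategory_scheme \<Rightarrow> 'm \<Rightarrow> 'm list \<Rightarrow> bool" where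
  "composable M f gs \<longleftrightarrow> f \<in> Mor M \<and> set gs \<subseteq> Mor M \<and> map (tgt M) gs = src M f"

locale multicategory =
  fixes M :: "('o, 'm, 'x) multicategory_scheme"
  assumes src_Obj: "f \<in> Mor M \<Longrightarrow> set (src M f) \<subseteq> Obj M"
    and tgt_Obj: "f \<in> Mor M \<Longrightarrow> tgt M f \<in> Obj M"
    and ident_Hom: "B \<in> Obj M \<Longrightarrow> ident M B \<in> Hom M [B] B"
    and mcomp_Hom:
      "composable M f gs \<Longrightarrow> mcomp M f gs \<in> Hom M (concat (map (src M) gs)) (tgt M f)"
    and mcomp_assoc:
      "\<lbrakk>composable M f gs; list_all2 (composable M) gs hss\<rbrakk>
       \<Longrightarrow> mcomp M (mcomp M f gs) (concat hss) = mcomp M f (map2 (mcomp M) gs hss)"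
    and ident_mcomp: "f \<in> Mor M \<Longrightarrow> mcomp M (ident M (tgt M f)) [f] = f"
    and mcomp_ident: "f \<in> Mor M \<Longrightarrow> mcomp M f (map (ident M) (src M f)) = f"

text \<open>\<open>act M As a f\<close> is \<open>[f]a\<close>, for \<open>f \<in> M(A\<^bsub>a(1)\<^esub>, \<dots>, A\<^bsub>a(m)\<^esub>; B)\<close>. As \<open>a\<close> need not be
  surjective, the source \<open>As = [A\<^sub>1, \<dots>, A\<^sub>n]\<close> of the result has to be given.\<close>

record ('o, 'm) S_multicategory = "('o, 'm) multicategory" +
  act :: "'o list \<Rightarrow> farr \<Rightarrow> 'm \<Rightarrow> 'm"

definition actable ::
    "farr set \<Rightarrow> ('o, 'm, 'x) multicategory_scheme \<Rightarrow> 'o list \<Rightarrow> farr \<Rightarrow> 'm \<Rightarrow> bool" where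
  "actable S M As a f \<longleftrightarrow>
     a \<in> S \<and> set As \<subseteq> Obj M \<and> length As = fcod a \<and> f \<in> Mor M \<and> src M f = reindex a As"

locale S_multicategory = faithful_cartesian_club S + multicategory M
  for S :: "farr set" and M :: "('o, 'm, 'x) S_multicategory_scheme" +
  assumes act_Hom:
      "actable S M As a f \<Longrightarrow> act M As a f \<in> Hom M As (tgt M f)"
    and act_act:
      "\<lbrakk>b \<in> S; set Bs \<subseteq> Obj M; length Bs = fcod b; fcod a = fdom b;
        actable S M (reindex b Bs) a f\<rbrakk>
       \<Longrightarrow> act M Bs b (act M (reindex b Bs) a f) = act M Bs (fcomp b a) f"
    and act_fid:
      "f \<in> Mor M \<Longrightarrow> act M (src M f) (fid (length (src M f))) f = f"
    and mcomp_act: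
      "\<lbrakk>\<forall>(As, a, f) \<in> set ts. actable S M As a f; composable M g (map (\<lambda>(As, a, f). f) ts)\<rbrakk>
       \<Longrightarrow> mcomp M g (map (\<lambda>(As, a, f). act M As a f) ts) =
           act M (concat (map (\<lambda>(As, a, f). As) ts)) (fsum (map (\<lambda>(As, a, f). a) ts))
             (mcomp M g (map (\<lambda>(As, a, f). f) ts))"
    and act_mcomp:
      "\<lbrakk>set fs \<subseteq> Mor M; actable S M (map (tgt M) fs) a g\<rbrakk>
       \<Longrightarrow> mcomp M (act M (map (tgt M) fs) a g) fs =
           act M (concat (map (src M) fs)) (wreath a (map (\<lambda>f. length (src M f)) fs))
             (mcomp M g (reindex a fs))"

definition sub_S_multicategory ::
    "farr set \<Rightarrow> ('o, 'm, 'x) S_multicategory_scheme \<Rightarrow> 'o set \<Rightarrow> 'm set \<Rightarrow> bool" where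
  "sub_S_multicategory S M Ob Mo \<longleftrightarrow>
     Ob \<subseteq> Obj M \<and> Mo \<subseteq> Mor M \<and>
     (\<forall>f\<in>Mo. set (src M f) \<subseteq> Ob \<and> tgt M f \<in> Ob) \<and>
     (\<forall>B\<in>Ob. ident M B \<in> Mo) \<and>
     (\<forall>f gs. f \<in> Mo \<and> set gs \<subseteq> Mo \<and> composable M f gs \<longrightarrow> mcomp M f gs \<in> Mo) \<and>
     (\<forall>As a f. f \<in> Mo \<and> set As \<subseteq> Ob \<and> actable S M As a f \<longrightarrow> act M As a f \<in> Mo)"

text \<open>Objects and morphisms of the smallest sub-\<open>S\<close>-multicategory containing the morphisms in \<open>X\<close>.\<close>

definition gen_Obj ::
    "farr set \<Rightarrow> ('o, 'm, 'x) S_multicategory_scheme \<Rightarrow> 'm set \<Rightarrow> 'o set" where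
  "gen_Obj S M X = \<Inter> {Ob. \<exists>Mo. sub_S_multicategory S M Ob Mo \<and> X \<subseteq> Mo}"

definition gen_Mor ::
    "farr set \<Rightarrow> ('o, 'm, 'x) S_multicategory_scheme \<Rightarrow> 'm set \<Rightarrow> 'm set" where
  "gen_Mor S M X = \<Inter> {Mo. \<exists>Ob. sub_S_multicategory S M Ob Mo \<and> X \<subseteq> Mo}"

lemma (in S_multicategory) sub_S_multicategory_whole:
  "sub_S_multicategory S M (Obj M) (Mor M)"
proof -
  have "ident M B \<in> Mor M" if "B \<in> Obj M" for B
    using ident_Hom[OF that] by (simp add: Hom_def)
  moreover have "mcomp M f gs \<in> Mor M" if "composable M f gs" for f gs
    using mcomp_Hom[OF that] by (simp add: Hom_def)
  moreover have "act M As a f \<in> Mor M" if "actable S M As a f" for As a f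
    using act_Hom[OF that] by (simp add: Hom_def)
  ultimately show ?thesis
    unfolding sub_S_multicategory_def by (simp add: src_Obj tgt_Obj)
qed

lemma (in S_multicategory) gen_sub_S_multicategory:
  assumes "X \<subseteq> Mor M"
  shows "sub_S_multicategory S M (gen_Obj S M X) (gen_Mor S M X)" and "X \<subseteq> gen_Mor S M X"
proof -
  note whole = sub_S_multicategory_whole
  let ?P = "\<lambda>Ob Mo. sub_S_multicategory S M Ob Mo \<and> X \<subseteq> Mo"
  have O: "x \<in> gen_Obj S M X \<longleftrightarrow> (\<forall>Ob Mo. ?P Ob Mo \<longrightarrow> x \<in> Ob)" for x
    unfolding gen_Obj_def by blast
  have M: "f \<in> gen_Mor S M X \<longleftrightarrow> (\<forall>Ob Mo. ?P Ob Mo \<longrightarrow> f \<in> Mo)" for f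
    unfolding gen_Mor_def by blast
  show "X \<subseteq> gen_Mor S M X" using M by blast
  have 1: "gen_Obj S M X \<subseteq> Obj M" "gen_Mor S M X \<subseteq> Mor M"
    unfolding gen_Obj_def gen_Mor_def using whole assms by blast+
  have 2: "set (src M f) \<subseteq> gen_Obj S M X \<and> tgt M f \<in> gen_Obj S M X"
    if h: "f \<in> gen_Mor S M X" for f
  proof -
    have "set (src M f) \<subseteq> Ob \<and> tgt M f \<in> Ob" if P: "?P Ob Mo" for Ob Mo
    proof -
      have "f \<in> Mo" using h M P by blast
      then show ?thesis using P unfolding sub_S_multicategory_def by blast
    qed
    then show ?thesis unfolding subset_iff O by blast
  qed
  have 3: "ident M B \<in> gen_Mor S M X" if h: "B \<in> gen_Obj S M X" for B
    unfolding M
  proof (intro allI impI)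
    fix Ob Mo assume P: "?P Ob Mo"
    then have "B \<in> Ob" using h O by blast
    then show "ident M B \<in> Mo" using P unfolding sub_S_multicategory_def by blast
  qed
  have 4: "mcomp M f gs \<in> gen_Mor S M X"
    if h: "f \<in> gen_Mor S M X" "set gs \<subseteq> gen_Mor S M X" "composable M f gs" for f gs
    unfolding M
  proof (intro allI impI)
    fix Ob Mo assume P: "?P Ob Mo"
    then have "f \<in> Mo" "set gs \<subseteq> Mo" using h M by blast+
    then show "mcomp M f gs \<in> Mo" using P h(3) unfolding sub_S_multicategory_def by blast
  qed
  have 5: "act M As a f \<in> gen_Mor S M X"
    if h: "f \<in> gen_Mor S M X" "set As \<subseteq> gen_Obj S M X" "actable S M As a f" for As a f
    unfolding M
  proof (intro allI impI)
    fix Ob Mo assume P: "?P Ob Mo"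
    then have "f \<in> Mo" "set As \<subseteq> Ob" using h M O by blast+
    then show "act M As a f \<in> Mo" using P h(3) unfolding sub_S_multicategory_def by blast
  qed
  show "sub_S_multicategory S M (gen_Obj S M X) (gen_Mor S M X)"
    unfolding sub_S_multicategory_def by (simp add: 1 2 3 4 5)
qed


section \<open>Applicative systems\<close>

definition applicative_system ::
    "('o, 'm, 'x) multicategory_scheme \<Rightarrow> 'o \<Rightarrow> 'm \<Rightarrow> bool" where
  "applicative_system M A app \<longleftrightarrow> A \<in> Obj M \<and> app \<in> Hom M [A, A] A"

fun app_pow :: "('o, 'm, 'x) multicategory_scheme \<Rightarrow> 'o \<Rightarrow> 'm \<Rightarrow> nat \<Rightarrow> 'm" where
  "app_pow M A app 0 = ident M A"
| "app_pow M A app (Suc n) = mcomp M app [app_pow M A app n, ident M A]"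

definition computable ::
    "('o, 'm, 'x) multicategory_scheme \<Rightarrow> 'o \<Rightarrow> 'm \<Rightarrow> 'm \<Rightarrow> bool" where
  "computable M A app f \<longleftrightarrow>
     (\<exists>n. f \<in> Hom M (replicate n A) A \<and>
        (\<exists>a \<in> Hom M [] A. f = mcomp M (app_pow M A app n) (a # replicate n (ident M A))))"

definition weakly_combinatory_complete ::
    "farr set \<Rightarrow> ('o, 'm, 'x) S_multicategory_scheme \<Rightarrow> 'o \<Rightarrow> 'm \<Rightarrow> bool" where
  "weakly_combinatory_complete S M A app \<longleftrightarrow>
     (\<forall>f \<in> gen_Mor S M {app}. computable M A app f)"

definition combinatory_complete ::
    "farr set \<Rightarrow> ('o, 'm, 'x) S_multicategory_scheme \<Rightarrow> 'o \<Rightarrow> 'm \<Rightarrow> bool" where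
  "combinatory_complete S M A app \<longleftrightarrow>
     (\<forall>f \<in> gen_Mor S M (insert app (Hom M [] A)). computable M A app f)"

definition flipped ::
    "('o, 'm, 'x) multicategory_scheme \<Rightarrow> 'o \<Rightarrow> 'm \<Rightarrow> bool" where
  "flipped M A app \<longleftrightarrow>
     (\<forall>a \<in> Hom M [] A. \<exists>h \<in> Hom M [] A.
        mcomp M app [h, ident M A] = mcomp M app [ident M A, a])"

end

theory Submission
  imports Defs
begin

text \<open>Write \<open>x y\<^sub>1 \<dots> y\<^sub>n\<close> for the left-nested application of morphisms with target \<open>A\<close>; then the
  computable morphisms are those of the form \<open>a 1 \<dots> 1\<close> with \<open>a\<close> an element. Flippedness gives
  \<open>u a = h u\<close> for every element \<open>a\<close>, so that in \<open>d 1 \<dots> 1 a 1 \<dots> 1\<close> the element \<open>a\<close> can be moved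
  to the left, yielding \<open>h (d 1 \<dots> 1) 1 \<dots> 1\<close>; by weak completeness this is \<open>e h d 1 \<dots> 1\<close> for some
  element \<open>e\<close>, and \<open>e h d\<close> is again an element. Hence elements can be substituted into computable
  morphisms, and closure of the computable morphisms under composition and under the action of the
  club reduces to weak completeness. Conversely, \<open>1 a\<close> is a unary morphism generated by
  \<open>\<bullet>\<close> and \<open>a\<close>, and being computable means that it equals \<open>h 1\<close>.\<close>

section \<open>Reindexing and wreath products along \<open>fplus (fid 1) a\<close>\<close>

lemma reindex_replicate:
  assumes "is_farr a"
  shows "reindex a (replicate (fcod a) x) = replicate (fdom a) x"
proof (rule nth_equalityI)
  fix i assume "i < length (reindex a (replicate (fcod a) x))"
  then have i: "Suc i \<in> {1..fdom a}" by simp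
  then have "fapp a (Suc i) \<in> {1..fcod a}"
    using assms unfolding is_farr_def by blast
  then show "reindex a (replicate (fcod a) x) ! i = replicate (fdom a) x ! i"
    using nth_reindex[OF i, of "replicate (fcod a) x"] i by auto
qed simp

lemma fdom_fplus_fid [simp]: "fdom (fplus (fid (Suc 0)) a) = Suc (fdom a)"
  and fcod_fplus_fid [simp]: "fcod (fplus (fid (Suc 0)) a) = Suc (fcod a)"
  by (simp_all add: fplus_def fid_def)

lemma fapp_fplus_fid_1: "fapp (fplus (fid 1) a) (Suc 0) = Suc 0"
  by (simp add: fplus_def fid_def)

lemma fapp_fplus_fid_Suc:
  "i \<in> {1..fdom a} \<Longrightarrow> fapp (fplus (fid 1) a) (Suc i) = Suc (fapp a i)"
  by (auto simp: fplus_def fid_def)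

lemma reindex_fplus_fid:
  assumes "is_farr a"
  shows "reindex (fplus (fid 1) a) (x # xs) = x # reindex a xs"
proof (rule nth_equalityI)
  fix i assume "i < length (reindex (fplus (fid 1) a) (x # xs))"
  then have i: "Suc i \<in> {1..fdom (fplus (fid 1) a)}" by simp
  note nth = nth_reindex[OF i, of "x # xs"]
  show "reindex (fplus (fid 1) a) (x # xs) ! i = (x # reindex a xs) ! i"
  proof (cases i)
    case 0
    then show ?thesis using nth fapp_fplus_fid_1[of a] by simp
  next
    case (Suc j)
    then have j: "Suc j \<in> {1..fdom a}" using i by simp
    then have "fapp a (Suc j) \<in> {1..fcod a}"
      using assms unfolding is_farr_def by blast
    then show ?thesis
      using nth nth_reindex[OF j, of xs] fapp_fplus_fid_Suc[OF j] Suc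
      by (auto simp: nth_Cons')
  qed
qed simp

text \<open>The extra fixed point carries an empty block and every other point a singleton block, so
  the blow-up deletes that point and leaves \<open>a\<close>. The sizes \<open>0, 1, ..., 1\<close>
  are the arities of an element followed by identities, which is how the wreath product arises in
  \<open>computable_act\<close>.\<close>

lemma wreath_fplus_fid:
  assumes a: "is_farr a"
  shows "wreath (fplus (fid 1) a) (0 # replicate (fcod a) 1) = a" (is "wreath ?b ?ks = a")
proof -
  have re: "reindex ?b ?ks = 0 # replicate (fdom a) 1"
    using reindex_fplus_fid[OF a, of 0 "replicate (fcod a) (1 :: nat)"]
      reindex_replicate[OF a, of "1 :: nat"] by simp
  have fd: "fdom (wreath ?b ?ks) = fdom a" and fc: "fcod (wreath ?b ?ks) = fcod a"
    using re by (simp_all add: wreath_def Let_def sum_list_replicate)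
  have "is_farr ?b" by (rule is_farr_fplus[OF is_farr_fid a])
  then have w: "is_farr (wreath ?b ?ks)" by (intro is_farr_wreath) simp_all
  have "fapp (wreath ?b ?ks) = fapp a"
  proof (rule extensionalityI)
    show "fapp (wreath ?b ?ks) \<in> extensional {1..fdom a}"
      using w fd unfolding is_farr_def by (auto simp: PiE_iff)
    show "fapp a \<in> extensional {1..fdom a}"
      using a unfolding is_farr_def by (auto simp: PiE_iff)
    fix x assume x: "x \<in> {1..fdom a}"
    then have ax: "fapp a x \<in> {1..fcod a}" using a unfolding is_farr_def by blast
    have bx: "fapp ?b (Suc x) = Suc (fapp a x)" using x by (rule fapp_fplus_fid_Suc)
    \<comment> \<open>The point \<open>x\<close> is the only element of block \<open>Suc x\<close>:
      block 1 is empty and blocks 2 to \<open>x\<close> contribute \<open>x - 1\<close>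
      points.\<close>
    have j: "Suc x \<in> {1..fdom ?b}" using x by simp
    have p: "1 \<in> {1..?ks ! (fapp ?b (Suc x) - 1)}"
      using ax bx by (auto simp: nth_Cons')
    have "sum_list (take x (0 # replicate (fdom a) 1)) = x - 1"
      "sum_list (take (fapp a x) (0 # replicate (fcod a) 1)) = fapp a x - 1"
      using x ax by (auto simp: take_Cons' sum_list_replicate)
    then show "fapp (wreath ?b ?ks) x = fapp a x"
      using fapp_wreath[OF j p] re bx x ax by simp
  qed
  then show ?thesis using fd fc by (simp add: farr.expand)
qed

section \<open>Calculus of iterated application\<close>

locale applicative_S_multicategory = S_multicategory S M
  for S :: "farr set" and M :: "('o, 'm, 'x) S_multicategory_scheme" +
  fixes A :: 'o and app :: 'm
  assumes applicative: "applicative_system M A app"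
begin

abbreviation ap :: "'m \<Rightarrow> 'm \<Rightarrow> 'm" where
  "ap f g \<equiv> mcomp M app [f, g]"

abbreviation \<iota> :: 'm where
  "\<iota> \<equiv> ident M A"

abbreviation ids :: "nat \<Rightarrow> 'm list" where
  "ids n \<equiv> replicate n \<iota>"

abbreviation aps :: "'m \<Rightarrow> 'm list \<Rightarrow> 'm" where
  "aps \<equiv> foldl ap"

text \<open>The source is left arbitrary: among morphisms with target \<open>A\<close>,
  composability only asks that the outer source be a list of copies of \<open>A\<close> of the right
  length.\<close>

definition Into :: "'m set" where
  "Into = {f \<in> Mor M. tgt M f = A}"

lemma Hom_eq_Into: "Hom M As A = {f \<in> Into. src M f = As}"
  by (auto simp: Hom_def Into_def)

lemma A_Obj: "A \<in> Obj M"
  using applicative by (simp add: applicative_system_def)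

lemma app_Into: "app \<in> Into" and src_app: "src M app = [A, A]"
  using applicative by (simp_all add: applicative_system_def Hom_eq_Into)

lemma ident_Into: "\<iota> \<in> Into" and src_ident: "src M \<iota> = [A]"
  using ident_Hom[OF A_Obj] by (simp_all add: Hom_eq_Into)

lemma ids_Into: "set (ids n) \<subseteq> Into"
  using ident_Into by (auto dest: in_set_replicate[THEN iffD1])

lemma concat_src_ids: "concat (map (src M) (ids n)) = replicate n A"
  by (induction n) (simp_all add: src_ident)

lemma composable_iff:
  assumes "f \<in> Into" and "set gs \<subseteq> Into"
  shows "composable M f gs \<longleftrightarrow> src M f = replicate (length gs) A"
proof -
  have "map (tgt M) gs = replicate (length gs) A"
    using assms(2) by (auto simp: Into_def intro!: replicate_eqI)
  then show ?thesis using assms by (auto simp: composable_def Into_def)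
qed

lemma composableI:
  "\<lbrakk>f \<in> Into; set gs \<subseteq> Into; src M f = replicate (length gs) A\<rbrakk> \<Longrightarrow> composable M f gs"
  by (simp add: composable_iff)

lemma mcomp_Into:
  assumes "composable M f gs" and "f \<in> Into"
  shows "mcomp M f gs \<in> Into" and "src M (mcomp M f gs) = concat (map (src M) gs)"
  using mcomp_Hom[OF assms(1)] assms(2) by (auto simp: Hom_def Into_def)

lemma composable_app: "\<lbrakk>f \<in> Into; g \<in> Into\<rbrakk> \<Longrightarrow> composable M app [f, g]"
  by (simp add: composable_iff app_Into src_app)

lemma ap_Into: "\<lbrakk>f \<in> Into; g \<in> Into\<rbrakk> \<Longrightarrow> ap f g \<in> Into"
  and src_ap: "\<lbrakk>f \<in> Into; g \<in> Into\<rbrakk> \<Longrightarrow> src M (ap f g) = src M f @ src M g"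
  using mcomp_Into[OF composable_app app_Into] by simp_all

lemma aps_Into: "\<lbrakk>f \<in> Into; set gs \<subseteq> Into\<rbrakk> \<Longrightarrow> aps f gs \<in> Into"
  by (induction gs arbitrary: f) (simp_all add: ap_Into)

lemma src_aps:
  "\<lbrakk>f \<in> Into; set gs \<subseteq> Into\<rbrakk> \<Longrightarrow> src M (aps f gs) = src M f @ concat (map (src M) gs)"
  by (induction gs arbitrary: f) (simp_all add: ap_Into src_ap)

lemma aps_ids_Into: "f \<in> Into \<Longrightarrow> aps f (ids n) \<in> Into"
  by (intro aps_Into ids_Into)

lemma src_aps_ids: "f \<in> Into \<Longrightarrow> src M (aps f (ids n)) = src M f @ replicate n A"
  using src_aps[OF _ ids_Into] concat_src_ids by simp

lemma ident_mcomp_Into: "f \<in> Into \<Longrightarrow> mcomp M \<iota> [f] = f"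
  using ident_mcomp[of f] by (auto simp: Into_def)

lemma mcomp_Nil: "\<lbrakk>f \<in> Into; src M f = []\<rbrakk> \<Longrightarrow> mcomp M f [] = f"
  using mcomp_ident[of f] by (auto simp: Into_def)

lemma mcomp_ids: "\<lbrakk>f \<in> Into; src M f = replicate n A\<rbrakk> \<Longrightarrow> mcomp M f (ids n) = f"
  using mcomp_ident[of f] by (auto simp: Into_def)

lemma mcomp_ap:
  assumes "f \<in> Into" "g \<in> Into" "composable M f hs" "composable M g ks"
  shows "mcomp M (ap f g) (hs @ ks) = ap (mcomp M f hs) (mcomp M g ks)"
  using mcomp_assoc[of app "[f, g]" "[hs, ks]"] assms by (simp add: composable_app)

lemma composable_ap:
  assumes "f \<in> Into" "g \<in> Into" "composable M f hs" "composable M g ks"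
  shows "composable M (ap f g) (hs @ ks)"
  using assms ap_Into[OF assms(1,2)] by (auto simp: composable_def src_ap Into_def)

text \<open>Associativity applied once per application. In the induction the head grows to
  \<open>ap f g\<close> and its inputs to \<open>hs @ ks\<close>, so both are generalised.\<close>

lemma mcomp_aps:
  assumes "list_all2 (composable M) gs hss" and "set gs \<subseteq> Into"
    and "f \<in> Into" and "composable M f hs"
  shows "mcomp M (aps f gs) (hs @ concat hss) = aps (mcomp M f hs) (map2 (mcomp M) gs hss)"
  using assms
proof (induction gs hss arbitrary: f hs rule: list_all2_induct)
  case (Cons g gs ks hss)
  then show ?case
    using Cons.IH[of "ap f g" "hs @ ks"] by (simp add: ap_Into composable_ap mcomp_ap)
qed simp

lemma mcomp_aps_ids:
  assumes "f \<in> Into" "composable M f hs" "set ys \<subseteq> Into"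
  shows "mcomp M (aps f (ids (length ys))) (hs @ ys) = aps (mcomp M f hs) ys"
proof -
  \<comment> \<open>Each \<open>y\<close> is fed to its own identity, so the input blocks of the
    arguments are singletons.\<close>
  have "list_all2 (composable M) (ids (length ys)) (map (\<lambda>y. [y]) ys)"
    using assms(3) ident_Into
    by (auto simp: list_all2_conv_all_nth composable_iff src_ident subset_iff)
  moreover have "map2 (mcomp M) (ids (length ys)) (map (\<lambda>y. [y]) ys) = ys"
    using assms(3) by (induction ys) (simp_all add: ident_mcomp_Into)
  moreover have "concat (map (\<lambda>y. [y]) ys) = ys" by (induction ys) simp_all
  ultimately show ?thesis
    using mcomp_aps[OF _ ids_Into assms(1,2)] by metis
qed

lemma mcomp_aps_elem:
  assumes "b \<in> Hom M [] A" "set ys \<subseteq> Into"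
  shows "mcomp M (aps b (ids (length ys))) ys = aps b ys"
  using mcomp_aps_ids[of b "[]" ys] assms by (simp add: Hom_eq_Into composable_iff mcomp_Nil)

text \<open>\<open>aps \<iota> (ids n)\<close> is the generic n-fold application, whose first input
  is the head. It contains only \<open>app\<close> and identities, so any head can be split off from
  a morphism generated by \<open>app\<close>.\<close>

lemma mcomp_aps_ident:
  assumes "x \<in> Into" "set ys \<subseteq> Into"
  shows "mcomp M (aps \<iota> (ids (length ys))) (x # ys) = aps x ys"
  using mcomp_aps_ids[of \<iota> "[x]" ys] assms
  by (simp add: ident_Into src_ident composable_iff ident_mcomp_Into)

lemma app_pow_eq: "app_pow M A app n = aps \<iota> (ids n)"
proof (induction n)
  case (Suc n)
  \<comment> \<open>\<open>app_pow\<close> adds its new argument last, so the list is split at its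
    end to match \<open>foldl\<close>.\<close>
  have "ids (Suc n) = ids n @ [\<iota>]" by (simp add: replicate_append_same)
  then show ?case using Suc by (simp del: replicate_Suc)
qed simp

lemma aps_elem_Hom: "a \<in> Hom M [] A \<Longrightarrow> aps a (ids n) \<in> Hom M (replicate n A) A"
  by (simp add: Hom_eq_Into aps_ids_Into src_aps_ids)

lemma computable_iff:
  "computable M A app f \<longleftrightarrow> (\<exists>n. \<exists>a \<in> Hom M [] A. f = aps a (ids n))"
proof -
  have "mcomp M (app_pow M A app n) (a # ids n) = aps a (ids n)"
    if "a \<in> Hom M [] A" for a n
    using mcomp_aps_ident[of a "ids n"] that ids_Into by (simp add: app_pow_eq Hom_eq_Into)
  then show ?thesis
    unfolding computable_def using aps_elem_Hom by metis
qed

text \<open>The number of identities is not a choice: an element has empty source, so it equals the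
  arity.\<close>

lemma computableE:
  assumes "computable M A app f" "src M f = replicate n A"
  obtains a where "a \<in> Hom M [] A" "f = aps a (ids n)"
proof -
  obtain m a where a: "a \<in> Hom M [] A" "f = aps a (ids m)"
    using assms(1) computable_iff by blast
  moreover have "src M f = replicate m A" using a aps_elem_Hom by (auto simp: Hom_def)
  then have "n = m" using assms(2) by (metis length_replicate)
  ultimately show thesis using that by blast
qed

lemma computable_Into: "computable M A app f \<Longrightarrow> f \<in> Into"
  and computable_src: "computable M A app f \<Longrightarrow> \<exists>n. src M f = replicate n A"
  by (auto simp: computable_def Hom_eq_Into)

section \<open>From combinatory completeness to flippedness\<close>

lemma flipped_of_combinatory_complete:
  assumes "combinatory_complete S M A app"
  shows "flipped M A app"
  unfolding flipped_def
proof
  fix a assume a: "a \<in> Hom M [] A"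
  then have aI: "a \<in> Into" and sa: "src M a = []" by (simp_all add: Hom_eq_Into)
  let ?X = "insert app (Hom M [] A)"
  have "?X \<subseteq> Mor M" using app_Into by (auto simp: Hom_def Into_def)
  note sub = gen_sub_S_multicategory[OF this]
  have app: "app \<in> gen_Mor S M ?X" and ag: "a \<in> gen_Mor S M ?X" using sub(2) a by auto
  then have "A \<in> gen_Obj S M ?X"
    using sub(1) src_app unfolding sub_S_multicategory_def by force
  then have "\<iota> \<in> gen_Mor S M ?X"
    using sub(1) unfolding sub_S_multicategory_def by blast
  then have "ap \<iota> a \<in> gen_Mor S M ?X"
    using sub(1) app ag composable_app[OF ident_Into aI]
    unfolding sub_S_multicategory_def by simp
  then have "computable M A app (ap \<iota> a)"
    using assms unfolding combinatory_complete_def by blast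
  moreover have "src M (ap \<iota> a) = replicate 1 A"
    by (simp add: src_ap ident_Into aI src_ident sa)
  ultimately obtain h where "h \<in> Hom M [] A" "ap \<iota> a = aps h (ids 1)"
    by (rule computableE)
  then show "\<exists>h \<in> Hom M [] A. ap h \<iota> = ap \<iota> a" by auto
qed

end

section \<open>Weak completeness: leading elements and the action of the club\<close>

locale weakly_complete = applicative_S_multicategory +
  assumes weakly_complete: "weakly_combinatory_complete S M A app"
begin

abbreviation Gen :: "'b set" where
  "Gen \<equiv> gen_Mor S M {app}"

lemma sub_Gen: "sub_S_multicategory S M (gen_Obj S M {app}) Gen"
  and app_Gen: "app \<in> Gen"
  using gen_sub_S_multicategory[of "{app}"] app_Into by (auto simp: Into_def)

lemma A_Gen: "A \<in> gen_Obj S M {app}"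
  using sub_Gen app_Gen src_app unfolding sub_S_multicategory_def by force

lemma ident_Gen: "\<iota> \<in> Gen"
  using sub_Gen A_Gen unfolding sub_S_multicategory_def by blast

lemma ap_Gen: "\<lbrakk>f \<in> Gen; g \<in> Gen; f \<in> Into; g \<in> Into\<rbrakk> \<Longrightarrow> ap f g \<in> Gen"
  using sub_Gen app_Gen composable_app unfolding sub_S_multicategory_def by simp

lemma aps_Gen:
  "\<lbrakk>f \<in> Gen; f \<in> Into; set gs \<subseteq> Gen; set gs \<subseteq> Into\<rbrakk> \<Longrightarrow> aps f gs \<in> Gen"
  by (induction gs arbitrary: f) (simp_all add: ap_Gen ap_Into)

lemma aps_ids_Gen: "\<lbrakk>f \<in> Gen; f \<in> Into\<rbrakk> \<Longrightarrow> aps f (ids n) \<in> Gen"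
  using ident_Gen ids_Into by (intro aps_Gen) auto

lemma computable_Gen: "f \<in> Gen \<Longrightarrow> computable M A app f"
  using weakly_complete unfolding weakly_combinatory_complete_def by blast

text \<open>Elements in the leading inputs are the first arguments of the representing element
  \<open>e\<close>, so \<open>aps e as\<close> is again an element and represents the
  result.\<close>

lemma computable_absorb:
  assumes f: "computable M A app f" and src: "src M f = replicate (length as + n) A"
    and as: "set as \<subseteq> Hom M [] A"
  shows "computable M A app (mcomp M f (as @ ids n))"
proof -
  obtain e where e: "e \<in> Hom M [] A" "f = aps e (ids (length as + n))"
    using computableE[OF f src] .
  have asI: "set as \<subseteq> Into" and "concat (map (src M) as) = []"
    using as by (auto simp: Hom_eq_Into)
  then have "aps e as \<in> Hom M [] A"
    using e(1) by (simp add: Hom_eq_Into aps_Into src_aps)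
  moreover have "mcomp M f (as @ ids n) = aps (aps e as) (ids n)"
    using mcomp_aps_elem[OF e(1), of "as @ ids n"] asI ids_Into e(2) by simp
  ultimately show ?thesis unfolding computable_iff by blast
qed

text \<open>Write \<open>f\<close> as the generic application \<open>?P\<close> with
  \<open>b\<close> as head. Acting on \<open>?P\<close> by \<open>fplus (fid 1) a\<close> fixes the
  head and yields a generated, hence computable, morphism. Absorbing \<open>b\<close> into it gives
  \<open>[f]a\<close>, by the law for composing after an action.\<close>

lemma computable_act:
  assumes f: "computable M A app f" and act: "actable S M As a f" and As: "set As \<subseteq> {A}"
  shows "computable M A app (act M As a f)"
proof -
  define m n where "m = fcod a" and "n = fdom a"
  have aS: "a \<in> S" and lenAs: "length As = m" and src: "src M f = reindex a As"
    using act by (auto simp: actable_def m_def)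
  have a: "is_farr a" using aS by (rule farr)
  have As_eq: "As = replicate m A" using As lenAs by (auto intro: replicate_eqI)
  note re = reindex_replicate[OF a, folded m_def n_def]
  obtain b where b: "b \<in> Hom M [] A" and f_eq: "f = aps b (ids n)"
    using computableE[OF f] src As_eq re by metis
  then have bI: "b \<in> Into" and srcb: "src M b = []" by (simp_all add: Hom_eq_Into)
  let ?c = "fplus (fid 1) a" and ?P = "aps \<iota> (ids n)" and ?Q = "b # ids m"
  have cS: "?c \<in> S" by (intro fplus_closed fid_closed aS)
  have tgts: "map (tgt M) ?Q = replicate (Suc m) A"
    using bI ident_Into by (simp add: Into_def)
  have P: "?P \<in> Gen" "?P \<in> Into" "src M ?P = replicate (Suc n) A"
    by (simp_all add: aps_ids_Gen aps_ids_Into ident_Gen ident_Into src_aps_ids src_ident)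
  have actP: "actable S M (map (tgt M) ?Q) ?c ?P"
    unfolding actable_def tgts
    using cS A_Obj P reindex_fplus_fid[OF a, of A "replicate m A"] re[of A]
    by (auto simp: Into_def simp flip: m_def n_def)
  moreover have "set (map (tgt M) ?Q) \<subseteq> gen_Obj S M {app}"
    unfolding tgts using A_Gen by (simp add: set_replicate_conv_if)
  ultimately have "act M (map (tgt M) ?Q) ?c ?P \<in> Gen"
    using sub_Gen P(1) unfolding sub_S_multicategory_def by blast
  then have comp: "computable M A app (act M (map (tgt M) ?Q) ?c ?P)"
    by (rule computable_Gen)
  have "src M (act M (map (tgt M) ?Q) ?c ?P) = replicate (length [b] + m) A"
    using act_Hom[OF actP] tgts by (simp add: Hom_def)
  from computable_absorb[OF comp this]
  have "computable M A app (mcomp M (act M (map (tgt M) ?Q) ?c ?P) ?Q)"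
    using b by simp
  \<comment> \<open>The action is moved outside the substitution of \<open>?Q\<close>. Inside, the
    reindexed list is \<open>b\<close> followed by \<open>n\<close> identities, which restores
    \<open>f\<close>; outside, the wreath product collapses to \<open>a\<close>.\<close>
  moreover have "mcomp M (act M (map (tgt M) ?Q) ?c ?P) ?Q =
      act M (concat (map (src M) ?Q)) (wreath ?c (map (\<lambda>f. length (src M f)) ?Q))
        (mcomp M ?P (reindex ?c ?Q))"
    using bI ids_Into actP by (intro act_mcomp) (auto simp: Into_def)
  moreover have "concat (map (src M) ?Q) = As"
    using srcb concat_src_ids As_eq by simp
  moreover have "map (\<lambda>f. length (src M f)) ?Q = 0 # replicate (fcod a) 1"
    by (simp add: srcb src_ident m_def)
  moreover have "mcomp M ?P (reindex ?c ?Q) = f"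
    using reindex_fplus_fid[OF a, of b "ids m"] re[of \<iota>]
      mcomp_aps_ident[OF bI ids_Into[of n]] f_eq by simp
  ultimately show ?thesis using wreath_fplus_fid[OF a] by (simp add: src_ident)
qed

section \<open>Flippedness: substitution of elements and closure under composition\<close>

context
  assumes flip: "flipped M A app"
begin

text \<open>Flippedness speaks of the identity only; substituting \<open>u\<close> for that identity
  on both sides gives the law for every \<open>u\<close>, with \<open>h\<close> independent of
  \<open>u\<close>.\<close>

lemma flipE:
  assumes "a \<in> Hom M [] A"
  obtains h where "h \<in> Hom M [] A" "\<And>u. u \<in> Into \<Longrightarrow> ap u a = ap h u"
proof -
  obtain h where h: "h \<in> Hom M [] A" "ap h \<iota> = ap \<iota> a"
    using flip assms unfolding flipped_def by blast
  have "ap u a = ap h u" if u: "u \<in> Into" for u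
  proof -
    have "mcomp M (ap \<iota> a) ([u] @ []) = ap u a"
      using mcomp_ap[of \<iota> a "[u]" "[]"] assms u
      by (simp add: Hom_eq_Into ident_Into composable_iff src_ident ident_mcomp_Into mcomp_Nil)
    moreover have "mcomp M (ap h \<iota>) ([] @ [u]) = ap h u"
      using mcomp_ap[of h \<iota> "[]" "[u]"] h(1) u
      by (simp add: Hom_eq_Into ident_Into composable_iff src_ident ident_mcomp_Into mcomp_Nil)
    ultimately show ?thesis using h(2) by simp
  qed
  then show thesis using h(1) that by blast
qed

text \<open>An element in a middle input cannot be absorbed directly. Flipping turns it into an
  element \<open>h\<close> at the head, in front of \<open>d\<close> and its first \<open>p\<close>
  arguments.\<close>

lemma computable_insert_elem:
  assumes f: "computable M A app f" and src: "src M f = replicate (Suc (p + q)) A"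
    and a: "a \<in> Hom M [] A"
  shows "computable M A app (mcomp M f (ids p @ a # ids q))"
proof -
  obtain d where d: "d \<in> Hom M [] A" and f_eq: "f = aps d (ids (Suc (p + q)))"
    using computableE[OF f src] .
  obtain h where h: "h \<in> Hom M [] A" and flip_a: "\<And>u. u \<in> Into \<Longrightarrow> ap u a = ap h u"
    using flipE[OF a] by blast
  have I: "d \<in> Into" "h \<in> Into" "a \<in> Into" and src0: "src M d = []" "src M h = []"
    using d h a by (simp_all add: Hom_eq_Into)
  have "mcomp M f (ids p @ a # ids q) = aps d (ids p @ a # ids q)"
    using mcomp_aps_elem[OF d, of "ids p @ a # ids q"] f_eq ids_Into I by simp
  also have "\<dots> = aps (ap h (aps d (ids p))) (ids q)"
    by (simp add: flip_a aps_ids_Into I)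
  finally have f_flip: "mcomp M f (ids p @ a # ids q) = aps (ap h (aps d (ids p))) (ids q)" .
  \<comment> \<open>\<open>V\<close> is the generated morphism \<open>x (y z1 ... zp)\<close>. With
    \<open>h\<close> and \<open>d\<close> abstracted into its first two inputs, they become leading
    elements that \<open>computable_absorb\<close> can handle.\<close>
  define U where "U = aps \<iota> (ids p)"
  define V where "V = ap \<iota> U"
  have U: "U \<in> Gen" "U \<in> Into" "src M U = replicate (Suc p) A"
    unfolding U_def
    by (simp_all add: aps_ids_Gen aps_ids_Into ident_Gen ident_Into src_aps_ids src_ident)
  have V: "V \<in> Gen" "V \<in> Into" "src M V = replicate (Suc (Suc p)) A"
    unfolding V_def using U
    by (simp_all add: ap_Gen ap_Into ident_Gen ident_Into src_ap src_ident)
  have "mcomp M U (d # ids p) = aps d (ids p)"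
    unfolding U_def using mcomp_aps_ident[OF I(1) ids_Into[of p]] by simp
  moreover have "composable M U (d # ids p)" "composable M \<iota> [h]"
    using U I by (auto intro!: composableI simp: ident_Into src_ident)
  ultimately have V_hd: "mcomp M V (h # d # ids p) = ap h (aps d (ids p))"
    unfolding V_def
    using mcomp_ap[of \<iota> U "[h]" "d # ids p"] U I by (simp add: ident_Into ident_mcomp_Into)
  have "composable M V (h # d # ids p)"
    using V I ident_Into by (auto intro!: composableI)
  then have "mcomp M (aps V (ids q)) (h # d # ids p @ ids q)
      = aps (ap h (aps d (ids p))) (ids q)"
    using mcomp_aps_ids[OF V(2) _ ids_Into[of q]] V_hd by fastforce
  then have "mcomp M f (ids p @ a # ids q) = mcomp M (aps V (ids q)) ([h, d] @ ids (p + q))"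
    using f_flip by (simp add: replicate_add)
  moreover have "computable M A app (aps V (ids q))"
    using aps_ids_Gen V by (intro computable_Gen) simp
  moreover have "src M (aps V (ids q)) = replicate (length [h, d] + (p + q)) A"
    using V by (simp add: src_aps_ids replicate_add)
  ultimately show ?thesis using computable_absorb[of _ "[h, d]"] h d by simp
qed

text \<open>The inputs are processed from left to right, \<open>p\<close> counting those kept so
  far. An identity in \<open>xs\<close> only raises \<open>p\<close>; an element replaces
  \<open>f\<close> by a computable morphism of arity one less.\<close>

lemma computable_subst_elems:
  assumes "computable M A app f" and "src M f = replicate (p + length xs) A"
    and "set xs \<subseteq> insert \<iota> (Hom M [] A)"
  shows "computable M A app (mcomp M f (ids p @ xs))"
  using assms
proof (induction xs arbitrary: p f)
  case Nil
  then show ?case using mcomp_ids computable_Into by simp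
next
  case (Cons x xs)
  have fI: "f \<in> Into" using Cons.prems(1) by (rule computable_Into)
  have xsI: "set xs \<subseteq> Into" using Cons.prems(3) ident_Into by (auto simp: Hom_eq_Into)
  show ?case
  proof (cases "x = \<iota>")
    case True
    have "ids p @ x # xs = ids (Suc p) @ xs"
      using True by (simp add: replicate_app_Cons_same)
    moreover have "computable M A app (mcomp M f (ids (Suc p) @ xs))"
      using Cons.prems by (intro Cons.IH) simp_all
    ultimately show ?thesis by (simp only:)
  next
    case False
    then have x: "x \<in> Hom M [] A" using Cons.prems(3) by auto
    then have xI: "x \<in> Into" and srcx: "src M x = []" by (simp_all add: Hom_eq_Into)
    let ?q = "length xs"
    let ?gs = "ids p @ x # ids ?q"
    \<comment> \<open>Inputs for the second stage of the substitution: \<open>x\<close> is an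
      element and takes none, every identity takes one.\<close>
    let ?hss = "replicate p [\<iota>] @ [] # map (\<lambda>y. [y]) xs"
    define g where "g = mcomp M f ?gs"
    have src: "src M f = replicate (Suc (p + ?q)) A" using Cons.prems(2) by simp
    have gsI: "set ?gs \<subseteq> Into" using xI ids_Into by auto
    have comp: "composable M f ?gs" using fI gsI src by (intro composableI) simp_all
    have g: "computable M A app g"
      unfolding g_def by (rule computable_insert_elem[OF Cons.prems(1) src x])
    have srcg: "src M g = replicate (p + ?q) A"
      unfolding g_def using mcomp_Into(2)[OF comp fI] concat_src_ids srcx
      by (simp add: replicate_add)
    have idI: "composable M \<iota> [y]" if "y \<in> Into" for y
      using that by (simp add: composable_iff ident_Into src_ident)
    have "list_all2 (composable M) (ids ?q) (map (\<lambda>y. [y]) xs)"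
      using xsI idI by (auto simp: list_all2_conv_all_nth subset_iff)
    moreover have "list_all2 (composable M) (ids p) (replicate p [\<iota>])"
      using idI[OF ident_Into] by (simp add: list_all2_conv_all_nth)
    moreover have "composable M x []" using xI srcx by (simp add: composable_iff)
    ultimately have all: "list_all2 (composable M) ?gs ?hss"
      by (simp add: list_all2_appendI)
    have "map2 (mcomp M) (ids ?q) (map (\<lambda>y. [y]) xs) = xs"
      using xsI by (induction xs) (simp_all add: ident_mcomp_Into)
    moreover have "map2 (mcomp M) (ids p) (replicate p [\<iota>]) = ids p"
      by (induction p) (simp_all add: ident_mcomp_Into ident_Into)
    ultimately have "map2 (mcomp M) ?gs ?hss = ids p @ x # xs"
      using xI srcx by (simp add: mcomp_Nil)
    moreover have "concat ?hss = ids p @ xs"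
      by (induction p) (simp_all add: concat_map_singleton)
    ultimately have "mcomp M f (ids p @ x # xs) = mcomp M g (ids p @ xs)"
      using mcomp_assoc[OF comp all] by (simp add: g_def ident_mcomp_Into ident_Into)
    then show ?thesis using Cons.IH[OF g srcg] Cons.prems(3) by simp
  qed
qed

text \<open>If \<open>b\<close> represents \<open>f\<close> and elements \<open>c g\<close>
  represent the inner morphisms, the composite is \<open>b\<close> applied to the terms
  \<open>c g 1 ... 1\<close>. Replacing all these elements by inputs leaves a generated morphism,
  into which they are substituted back.\<close>

lemma computable_mcomp:
  assumes f: "computable M A app f" and gs: "\<And>g. g \<in> set gs \<Longrightarrow> computable M A app g"
    and comp: "composable M f gs"
  shows "computable M A app (mcomp M f gs)"
proof -
  have gsI: "set gs \<subseteq> Into" using gs computable_Into by blast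
  have "src M f = replicate (length gs) A"
    using composable_iff[OF computable_Into[OF f] gsI] comp by simp
  then obtain b where b: "b \<in> Hom M [] A" and f_eq: "f = aps b (ids (length gs))"
    using computableE[OF f] by blast
  have bI: "b \<in> Into" using b by (simp add: Hom_eq_Into)
  have "\<forall>g \<in> set gs. \<exists>n c. c \<in> Hom M [] A \<and> g = aps c (ids n)"
    using gs unfolding computable_iff by blast
  \<comment> \<open>The representatives are functions of the morphism, not of its position, so
    repeated entries of \<open>gs\<close> share theirs.\<close>
  then obtain k c where c: "\<And>g. g \<in> set gs \<Longrightarrow> c g \<in> Hom M [] A"
    and g_eq: "\<And>g. g \<in> set gs \<Longrightarrow> g = aps (c g) (ids (k g))"
    by metis
  \<comment> \<open>\<open>ps\<close> holds the generic applications obtained by abstracting the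
    representing elements; \<open>hss\<close> holds the inputs that recover each
    \<open>g\<close>.\<close>
  define ps where "ps = map (\<lambda>g. aps \<iota> (ids (k g))) gs"
  define hss where "hss = map (\<lambda>g. c g # ids (k g)) gs"
  have cI: "c g \<in> Into" if "g \<in> set gs" for g
    using c[OF that] by (simp add: Hom_eq_Into)
  have psI: "set ps \<subseteq> Into" and psG: "set ps \<subseteq> Gen"
    unfolding ps_def by (auto simp: aps_ids_Into aps_ids_Gen ident_Into ident_Gen)
  have "composable M (aps \<iota> (ids (k g))) (c g # ids (k g))" if "g \<in> set gs" for g
    using cI[OF that] ids_Into
    by (intro composableI) (auto simp: aps_ids_Into ident_Into src_aps_ids src_ident)
  then have all: "list_all2 (composable M) ps hss"
    by (simp add: ps_def hss_def list_all2_map1 list_all2_map2 list.rel_refl_strong)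
  have "mcomp M (aps \<iota> (ids (k g))) (c g # ids (k g)) = g" if "g \<in> set gs" for g
    using mcomp_aps_ident[OF cI[OF that] ids_Into[of "k g"]] g_eq[OF that] by simp
  then have "map2 (mcomp M) ps hss = gs"
    by (auto simp: ps_def hss_def map2_map_map intro: map_idI)
  then have "mcomp M (aps \<iota> ps) ([b] @ concat hss) = aps b gs"
    using mcomp_aps[OF all psI ident_Into, of "[b]"] bI
    by (simp add: composable_iff ident_Into src_ident ident_mcomp_Into)
  moreover have "mcomp M f gs = aps b gs"
    using mcomp_aps_elem[OF b gsI] f_eq by simp
  ultimately have eq: "mcomp M f gs = mcomp M (aps \<iota> ps) (ids 0 @ b # concat hss)" by simp
  have "aps \<iota> ps \<in> Gen" by (intro aps_Gen ident_Gen ident_Into psG psI)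
  then have "computable M A app (aps \<iota> ps)" by (rule computable_Gen)
  moreover have "concat (map (src M) ps) = replicate (length (concat hss)) A"
    unfolding ps_def hss_def
    by (induction gs) (simp_all add: src_aps_ids ident_Into src_ident replicate_add)
  then have "src M (aps \<iota> ps) = replicate (0 + length (b # concat hss)) A"
    using src_aps[OF ident_Into psI] by (simp add: src_ident)
  moreover have "set (b # concat hss) \<subseteq> insert \<iota> (Hom M [] A)"
    using b c by (auto simp: hss_def)
  ultimately show ?thesis unfolding eq by (rule computable_subst_elems)
qed

text \<open>The computable morphisms, on the single object \<open>A\<close>, form a
  sub-multicategory containing \<open>app\<close> and all elements, so the smallest such one lies
  inside it.\<close>

lemma combinatory_complete_of_flipped: "combinatory_complete S M A app"
proof -
  let ?C = "{f. computable M A app f}"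
  have "sub_S_multicategory S M {A} ?C"
    unfolding sub_S_multicategory_def
  proof (intro conjI allI ballI impI)
    show "{A} \<subseteq> Obj M" using A_Obj by simp
    show "?C \<subseteq> Mor M" using computable_Into by (auto simp: Into_def)
    show "set (src M f) \<subseteq> {A}" if "f \<in> ?C" for f
      using that computable_src by force
    show "tgt M f \<in> {A}" if "f \<in> ?C" for f
      using that computable_Into by (auto simp: Into_def)
    show "ident M B \<in> ?C" if "B \<in> {A}" for B
      using that computable_Gen[OF ident_Gen] by simp
    show "mcomp M f gs \<in> ?C" if "f \<in> ?C \<and> set gs \<subseteq> ?C \<and> composable M f gs" for f gs
      using that computable_mcomp by blast
    show "act M As a f \<in> ?C" if "f \<in> ?C \<and> set As \<subseteq> {A} \<and> actable S M As a f" for As a f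
      using that computable_act by blast
  qed
  \<comment> \<open>An element represents itself, with no arguments.\<close>
  moreover have "a \<in> ?C" if "a \<in> Hom M [] A" for a
    unfolding mem_Collect_eq computable_iff
    using that by (intro exI[of _ 0] bexI[of _ a]) simp_all
  then have "insert app (Hom M [] A) \<subseteq> ?C"
    using computable_Gen[OF app_Gen] by blast
  ultimately show ?thesis
    unfolding combinatory_complete_def gen_Mor_def by blast
qed

end

end

theorem theorem4p6:
  fixes S :: "farr set" and M :: "('o, 'm) S_multicategory" and A :: 'o and app :: 'm
  assumes "faithful_cartesian_club S"
    and "S_multicategory S M"
    and "applicative_system M A app"
    and "weakly_combinatory_complete S M A app"
  shows "flipped M A app \<longleftrightarrow> combinatory_complete S M A app"
proof -
  interpret S_multicategory S M by fact
  interpret weakly_complete S M A app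
    by unfold_locales fact+
  show ?thesis
    using flipped_of_combinatory_complete combinatory_complete_of_flipped by blast
qed

end
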